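(* Let $\mathfrak{G}$ be an étale groupoid with compact totally disconnected metrizable space of units $\mathfrak{G}^{(0)}$, and let $\Bbbk$ be a field. Let $\mathcal{S}$ be a finite set of open compact $\mathfrak{G}$-bisections such that $S=\bigcup\mathcal{S}$ is a generating set of $\mathfrak{G}$. Let $V\subset\Bbbk[\mathfrak{G}]$ be the $\Bbbk$-linear span of the characteristic functions $1_F$ of the elements $F\in\mathcal{S}$. Then for every $n\ge 1$ \[\dim V^n\le\overline\gamma(n,\mathcal{S})\,\delta(n,\mathcal{S}),\] where $\overline\gamma(n,\mathcal{S})=\max_{x\in\mathfrak{G}^{(0)}}\gamma_S(x,n)$.
   Context: A groupoid $\mathfrak{G}$ is (the set of morphisms of) a small category of isomorphisms; $\mathfrak{G}^{(0)}$ is its set of units, $\mathsf{o}(g)=g^{-1}g$ is the origin and $\mathsf{t}(g)=gg^{-1}$ the target of $g$; the product $g_1g_2$ is defined iff $\mathsf{t}(g_2)=\mathsf{o}(g_1)$. For $x\in\mathfrak{G}^{(0)}$, $\mathfrak{G}_x=\{g\in\mathfrak{G}:\mathsf{o}(g)=x\}$. A topological groupoid has a topology making multiplication and inversion continuous; $\mathfrak{G}$ is not required to be Hausdorff. A $\mathfrak{G}$-bisection is a subset $F\subset\mathfrak{G}$ such that $\mathsf{o}:F\to\mathsf{o}(F)$ and $\mathsf{t}:F\to\mathsf{t}(F)$ are homeomorphisms. $\mathfrak{G}$ is étale if the open $\mathfrak{G}$-bisections form a basis of its topology. Compact sets are not required to be closed or Hausdorff. A generating set of $\mathfrak{G}$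 is an open compact subset $S\subset\mathfrak{G}$ such that $\mathfrak{G}=\bigcup_{n\ge 0}(S\cup S^{-1})^n$, where $(S\cup S^{-1})^0=\mathfrak{G}^{(0)}$. Cayley graph: $\mathfrak{G}(x,\mathcal{S})$ is the oriented labeled graph with vertex set $\mathfrak{G}_x$, with an arrow from $g_1$ to $g_2$ labeled by $A\in\mathcal{S}$ whenever there is $s\in A$ with $g_2=sg_1$. Its root is $x$. Distances are measured ignoring orientation. $B_{\mathcal{S}}(x,n)$ is the ball of radius $n$ centered at $x$ (the subgraph induced on the vertices at distance at most $n$ from $x$), viewed as a rooted oriented labeled graph. $\gamma_S(x,n)$ is the number of vertices of $B_{\mathcal{S}}(x,n)$, i.e., the number of elements of $\mathfrak{G}_x$ that are products of at most $n$ elements of $S\cup S^{-1}$ (the unit $x$ being the empty product). For units $x,y$ write $x\sim_n y$ if $B_{\mathcal{S}}(x,n)$ and $B_{\mathcal{S}}(y,n)$ are isomorphic as rooted oriented labeled graphs. The complexity $\delta(n,\mathcal{S})$ is the (finite) number of $\sim_n$-equivalence classes on $\mathfrak{G}^{(0)}$. Convolution of functions is $(f_1*f_2)(g)=\sum_{h\in\mathfrak{G}_{\mathsf{o}(g)}}f_1(gh^{-1})f_2(h)$. The convolution algebra $\Bbbk[\mathfrak{G}]$ is the $\Bbbk$-algebra (under convolution) generated by the characteristic functions $1_F$ of open compact $\mathfrak{G}$-bisections $F$. $V^n$ denotes the $\Bbbk$-linear span of all products $a_1a_2\cdots a_n$ with $a_i\in V$. *)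

theory Defs
  imports "HOL-Analysis.Analysis" "HOL-Library.Function_Algebras"
begin

section \<open>Groupoids\<close>

record 'g groupoid =
  arrows :: "'g set"
  comp :: "'g \<Rightarrow> 'g \<Rightarrow> 'g" (infixl \<open>\<cdot>\<index>\<close> 70)
  ginv :: "'g \<Rightarrow> 'g"

definition orig :: "('g, 'm) groupoid_scheme \<Rightarrow> 'g \<Rightarrow> 'g"
  where "orig G g = ginv G g \<cdot>\<^bsub>G\<^esub> g"

definition targ :: "('g, 'm) groupoid_scheme \<Rightarrow> 'g \<Rightarrow> 'g"
  where "targ G g = g \<cdot>\<^bsub>G\<^esub> ginv G g"

definition units :: "('g, 'm) groupoid_scheme \<Rightarrow> 'g set"
  where "units G = orig G ` arrows G"

definition star :: "('g, 'm) groupoid_scheme \<Rightarrow> 'g \<Rightarrow> 'g set"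
  where "star G x = {g \<in> arrows G. orig G g = x}"

text \<open>
  The morphisms of a small category in which every morphism is invertible, objects being
  identified with their identity morphisms.  The operations are total functions; their values
  on arguments that are not arrows, or not composable, carry no meaning.
\<close>

locale groupoid =
  fixes G :: "('g, 'm) groupoid_scheme" (structure)
  assumes inv_closed: "g \<in> arrows G \<Longrightarrow> ginv G g \<in> arrows G"
    and comp_closed:
      "\<lbrakk>g \<in> arrows G; h \<in> arrows G; targ G h = orig G g\<rbrakk> \<Longrightarrow> g \<cdot> h \<in> arrows G"
    and orig_inv: "g \<in> arrows G \<Longrightarrow> orig G (ginv G g) = targ G g"
    and targ_inv: "g \<in> arrows G \<Longrightarrow> targ G (ginv G g) = orig G g"
    and orig_comp:
      "\<lbrakk>g \<in> arrows G; h \<in> arrows G; targ G h = orig G g\<rbrakk> \<Longrightarrow> orig G (g \<cdot> h) = orig G h"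
    and targ_comp:
      "\<lbrakk>g \<in> arrows G; h \<in> arrows G; targ G h = orig G g\<rbrakk> \<Longrightarrow> targ G (g \<cdot> h) = targ G g"
    and comp_assoc:
      "\<lbrakk>f \<in> arrows G; g \<in> arrows G; h \<in> arrows G; targ G g = orig G f; targ G h = orig G g\<rbrakk>
        \<Longrightarrow> (f \<cdot> g) \<cdot> h = f \<cdot> (g \<cdot> h)"
    and comp_orig: "g \<in> arrows G \<Longrightarrow> g \<cdot> orig G g = g"
    and targ_comp_id: "g \<in> arrows G \<Longrightarrow> targ G g \<cdot> g = g"

definition set_comp :: "('g, 'm) groupoid_scheme \<Rightarrow> 'g set \<Rightarrow> 'g set \<Rightarrow> 'g set"
  where "set_comp G A B = {g \<cdot>\<^bsub>G\<^esub> h | g h. g \<in> A \<and> h \<in> B \<and> targ G h = orig G g}"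

primrec set_pow :: "('g, 'm) groupoid_scheme \<Rightarrow> 'g set \<Rightarrow> nat \<Rightarrow> 'g set"
  where
    "set_pow G A 0 = units G"
  | "set_pow G A (Suc n) = set_comp G A (set_pow G A n)"

section \<open>Topological and etale groupoids\<close>

record 'g top_groupoid = "'g groupoid" +
  topo :: "'g topology"

locale topological_groupoid = groupoid G
  for G :: "('g, 'm) top_groupoid_scheme" (structure) +
  assumes topspace_topo: "topspace (topo G) = arrows G"
    and continuous_comp:
      "continuous_map
        (subtopology (prod_topology (topo G) (topo G)) {(g, h). targ G h = orig G g})
        (topo G) (\<lambda>(g, h). g \<cdot> h)"
    and continuous_inv: "continuous_map (topo G) (topo G) (ginv G)"

definition bisection :: "('g, 'm) top_groupoid_scheme \<Rightarrow> 'g set \<Rightarrow> bool"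
  where "bisection G F \<longleftrightarrow>
    F \<subseteq> arrows G \<and>
    homeomorphic_map (subtopology (topo G) F) (subtopology (topo G) (orig G ` F)) (orig G) \<and>
    homeomorphic_map (subtopology (topo G) F) (subtopology (topo G) (targ G ` F)) (targ G)"

locale etale_groupoid = topological_groupoid G
  for G :: "('g, 'm) top_groupoid_scheme" (structure) +
  assumes open_bisections_basis:
    "openin (topo G) = arbitrary union_of (\<lambda>F. openin (topo G) F \<and> bisection G F)"

definition open_compact_bisection :: "('g, 'm) top_groupoid_scheme \<Rightarrow> 'g set \<Rightarrow> bool"
  where "open_compact_bisection G F \<longleftrightarrow>
    openin (topo G) F \<and> compactin (topo G) F \<and> bisection G F"

definition unit_space :: "('g, 'm) top_groupoid_scheme \<Rightarrow> 'g topology"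
  where "unit_space G = subtopology (topo G) (units G)"

definition totally_disconnected_space :: "'a topology \<Rightarrow> bool"
  where "totally_disconnected_space X \<longleftrightarrow>
    (\<forall>x \<in> topspace X. connected_component_of_set X x = {x})"

definition generating_set :: "('g, 'm) top_groupoid_scheme \<Rightarrow> 'g set \<Rightarrow> bool"
  where "generating_set G S \<longleftrightarrow>
    openin (topo G) S \<and> compactin (topo G) S \<and>
    arrows G = (\<Union>n. set_pow G (S \<union> ginv G ` S) n)"

section \<open>Rooted oriented labeled graphs\<close>

text \<open>An arrow from \<open>u\<close> to \<open>v\<close> with label \<open>a\<close> is the triple \<open>(u, a, v)\<close>.\<close>

record ('v, 'l) rooted_graph =
  verts :: "'v set"
  edges :: "('v \<times> 'l \<times> 'v) set"
  root :: 'v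

definition adjacent :: "('v, 'l) rooted_graph \<Rightarrow> ('v \<times> 'v) set"
  where "adjacent \<Gamma> = {(u, v). \<exists>a. (u, a, v) \<in> edges \<Gamma> \<or> (v, a, u) \<in> edges \<Gamma>}"

definition graph_dist :: "('v, 'l) rooted_graph \<Rightarrow> 'v \<Rightarrow> 'v \<Rightarrow> enat"
  where "graph_dist \<Gamma> u v = (INF k \<in> {k. (u, v) \<in> adjacent \<Gamma> ^^ k}. enat k)"

definition induced_subgraph :: "('v, 'l) rooted_graph \<Rightarrow> 'v set \<Rightarrow> ('v, 'l) rooted_graph"
  where "induced_subgraph \<Gamma> W =
    \<lparr>verts = W, edges = {(u, a, v). (u, a, v) \<in> edges \<Gamma> \<and> u \<in> W \<and> v \<in> W}, root = root \<Gamma>\<rparr>"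

definition graph_ball :: "('v, 'l) rooted_graph \<Rightarrow> nat \<Rightarrow> ('v, 'l) rooted_graph"
  where "graph_ball \<Gamma> n =
    induced_subgraph \<Gamma> {v \<in> verts \<Gamma>. graph_dist \<Gamma> (root \<Gamma>) v \<le> enat n}"

definition rooted_graph_iso :: "('v, 'l) rooted_graph \<Rightarrow> ('w, 'l) rooted_graph \<Rightarrow> bool"
  where "rooted_graph_iso \<Gamma> \<Delta> \<longleftrightarrow>
    (\<exists>\<phi>. bij_betw \<phi> (verts \<Gamma>) (verts \<Delta>) \<and> \<phi> (root \<Gamma>) = root \<Delta> \<and>
      (\<forall>u \<in> verts \<Gamma>. \<forall>v \<in> verts \<Gamma>. \<forall>a.
        (u, a, v) \<in> edges \<Gamma> \<longleftrightarrow> (\<phi> u, a, \<phi> v) \<in> edges \<Delta>))"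

section \<open>Cayley graphs, growth and complexity\<close>

definition cayley_graph ::
    "('g, 'm) groupoid_scheme \<Rightarrow> 'g set set \<Rightarrow> 'g \<Rightarrow> ('g, 'g set) rooted_graph"
  where "cayley_graph G \<S> x =
    \<lparr>verts = star G x,
     edges = {(g\<^sub>1, A, g\<^sub>2). g\<^sub>1 \<in> star G x \<and> g\<^sub>2 \<in> star G x \<and> A \<in> \<S> \<and>
       (\<exists>s \<in> A. targ G g\<^sub>1 = orig G s \<and> g\<^sub>2 = s \<cdot>\<^bsub>G\<^esub> g\<^sub>1)},
     root = x\<rparr>"

definition cayley_ball ::
    "('g, 'm) groupoid_scheme \<Rightarrow> 'g set set \<Rightarrow> 'g \<Rightarrow> nat \<Rightarrow> ('g, 'g set) rooted_graph"
  where "cayley_ball G \<S> x n = graph_ball (cayley_graph G \<S> x) n"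

definition growth :: "('g, 'm) groupoid_scheme \<Rightarrow> 'g set set \<Rightarrow> 'g \<Rightarrow> nat \<Rightarrow> nat"
  where "growth G \<S> x n = card (verts (cayley_ball G \<S> x n))"

definition max_growth :: "('g, 'm) groupoid_scheme \<Rightarrow> 'g set set \<Rightarrow> nat \<Rightarrow> nat"
  where "max_growth G \<S> n = Max ((\<lambda>x. growth G \<S> x n) ` units G)"

definition ball_equiv ::
    "('g, 'm) groupoid_scheme \<Rightarrow> 'g set set \<Rightarrow> nat \<Rightarrow> ('g \<times> 'g) set"
  where "ball_equiv G \<S> n = {(x, y). x \<in> units G \<and> y \<in> units G \<and>
    rooted_graph_iso (cayley_ball G \<S> x n) (cayley_ball G \<S> y n)}"

definition complexity :: "('g, 'm) groupoid_scheme \<Rightarrow> 'g set set \<Rightarrow> nat \<Rightarrow> nat"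
  where "complexity G \<S> n = card (units G // ball_equiv G \<S> n)"

section \<open>The convolution algebra\<close>

text \<open>
  Functions on the groupoid are functions on the ambient type that vanish off \<open>arrows G\<close>,
  with pointwise addition and the following pointwise scalar multiplication.
\<close>

global_interpretation fun_space:
  vector_space "\<lambda>(c :: 'k::field) (f :: 'g \<Rightarrow> 'k) x. c * f x"
  by unfold_locales (auto simp: fun_eq_iff algebra_simps)

text \<open>
  The sum is restricted to its non-zero terms, because the library's sum over an infinite
  index set is \<open>0\<close>.  For elements of the convolution algebra only finitely many terms are
  non-zero, since a bisection meets each \<open>star G x\<close> in at most one point.
\<close>

definition conv :: "('g, 'm) groupoid_scheme \<Rightarrow> ('g \<Rightarrow> 'k::field) \<Rightarrow> ('g \<Rightarrow> 'k) \<Rightarrow> 'g \<Rightarrow> 'k"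
  where "conv G f\<^sub>1 f\<^sub>2 g =
    (if g \<in> arrows G
     then \<Sum>h | h \<in> star G (orig G g) \<and> f\<^sub>1 (g \<cdot>\<^bsub>G\<^esub> ginv G h) * f\<^sub>2 h \<noteq> 0.
            f\<^sub>1 (g \<cdot>\<^bsub>G\<^esub> ginv G h) * f\<^sub>2 h
     else 0)"

inductive_set conv_algebra :: "('g, 'm) top_groupoid_scheme \<Rightarrow> ('g \<Rightarrow> 'k::field) set"
  for G :: "('g, 'm) top_groupoid_scheme"
  where
    char_fun: "open_compact_bisection G F \<Longrightarrow> indicator F \<in> conv_algebra G"
  | zero: "0 \<in> conv_algebra G"
  | add: "a \<in> conv_algebra G \<Longrightarrow> b \<in> conv_algebra G \<Longrightarrow> a + b \<in> conv_algebra G"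
  | scale: "a \<in> conv_algebra G \<Longrightarrow> (\<lambda>g. c * a g) \<in> conv_algebra G"
  | conv: "a \<in> conv_algebra G \<Longrightarrow> b \<in> conv_algebra G \<Longrightarrow> conv G a b \<in> conv_algebra G"

text \<open>The empty product is the unit of the algebra, the characteristic function of the units.\<close>

fun conv_list :: "('g, 'm) groupoid_scheme \<Rightarrow> ('g \<Rightarrow> 'k::field) list \<Rightarrow> 'g \<Rightarrow> 'k"
  where
    "conv_list G [] = indicator (units G)"
  | "conv_list G [a] = a"
  | "conv_list G (a # b # as) = conv G a (conv_list G (b # as))"

definition conv_power ::
    "('g, 'm) groupoid_scheme \<Rightarrow> ('g \<Rightarrow> 'k::field) set \<Rightarrow> nat \<Rightarrow> ('g \<Rightarrow> 'k) set"
  where "conv_power G V n =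
    fun_space.span {conv_list G as | as. length as = n \<and> set as \<subseteq> V}"

subsection \<open>The powers are finite-dimensional subspaces of the algebra\<close>

text \<open>
  \<open>fun_space.dim\<close> is \<open>0\<close> on infinite-dimensional subspaces.  The following facts show that the
  powers of the span of finitely many open compact bisections lie in the convolution algebra
  and are finite-dimensional, so that \<open>fun_space.dim\<close> is their dimension in the usual sense.
\<close>

lemma span_in_conv_algebra:
  assumes "B \<subseteq> conv_algebra G"
  shows "fun_space.span B \<subseteq> conv_algebra G"
proof
  fix a assume "a \<in> fun_space.span B"
  then show "a \<in> conv_algebra G"
  proof (induction rule: fun_space.span_induct_alt)
    case base
    show ?case by (rule conv_algebra.zero)
  next
    case (step c x y)
    have "(\<lambda>g. c * x g) \<in> conv_algebra G"
      using assms step by (intro conv_algebra.scale) auto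
    then show ?case
      using step by (intro conv_algebra.add)
  qed
qed

lemma conv_list_in_conv_algebra:
  assumes "set as \<subseteq> conv_algebra G" "as \<noteq> []"
  shows "conv_list G as \<in> conv_algebra G"
  using assms by (induction G as rule: conv_list.induct) (auto intro: conv_algebra.conv)

lemma conv_power_in_conv_algebra:
  assumes "\<And>F. F \<in> \<S> \<Longrightarrow> open_compact_bisection G F" "n \<ge> 1"
  shows "conv_power G (fun_space.span (indicator ` \<S>)) n \<subseteq> conv_algebra G"
proof -
  have "fun_space.span (indicator ` \<S>) \<subseteq> conv_algebra G"
    by (rule span_in_conv_algebra) (use assms(1) in \<open>auto intro: conv_algebra.char_fun\<close>)
  then show ?thesis
    unfolding conv_power_def using assms(2)
    by (intro span_in_conv_algebra) (auto intro!: conv_list_in_conv_algebra)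
qed

definition star_finite :: "('g, 'm) groupoid_scheme \<Rightarrow> ('g \<Rightarrow> 'k::field) \<Rightarrow> bool"
  where "star_finite G f \<longleftrightarrow> (\<forall>x. finite {h \<in> star G x. f h \<noteq> 0})"

lemma star_finite_bisection:
  assumes "topological_groupoid G" "bisection G F"
  shows "star_finite G (indicator F :: 'g \<Rightarrow> 'k::field)"
  unfolding star_finite_def
proof
  fix x
  have "topspace (topo G) \<inter> F = F"
    using assms by (auto simp: bisection_def topological_groupoid.topspace_topo)
  then have inj: "inj_on (orig G) F"
    using assms by (auto simp: bisection_def homeomorphic_map_def)
  have "{h \<in> star G x. indicator F h \<noteq> (0::'k)} = {h \<in> star G x. h \<in> F}"
    by (auto simp: indicator_def)
  moreover have "finite {h \<in> star G x. h \<in> F}"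
  proof (rule finite_subset)
    show "{h \<in> star G x. h \<in> F} \<subseteq> {inv_into F (orig G) x}"
      using inj by (auto simp: star_def)
  qed simp
  ultimately show "finite {h \<in> star G x. indicator F h \<noteq> (0::'k)}"
    by simp
qed

lemma star_finite_zero: "star_finite G 0"
  by (simp add: star_finite_def)

lemma star_finite_comb:
  assumes "star_finite G a" "star_finite G b"
  shows "star_finite G ((\<lambda>g. c * a g) + b)"
  unfolding star_finite_def
proof
  fix x
  have "finite ({h \<in> star G x. a h \<noteq> 0} \<union> {h \<in> star G x. b h \<noteq> 0})"
    using assms by (simp add: star_finite_def)
  then show "finite {h \<in> star G x. ((\<lambda>g. c * a g) + b) h \<noteq> 0}"
    by (rule rev_finite_subset) auto
qed

lemma star_finite_span:
  assumes "\<And>b. b \<in> B \<Longrightarrow> star_finite G b" "a \<in> fun_space.span B"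
  shows "star_finite G a"
  using assms(2)
proof (induction rule: fun_space.span_induct_alt)
  case base
  show ?case by (rule star_finite_zero)
next
  case (step c x y)
  then show ?case using assms(1) by (intro star_finite_comb) auto
qed

lemma conv_eq_sum:
  assumes "g \<in> arrows G" "finite A" "A \<subseteq> star G (orig G g)"
    and "{h \<in> star G (orig G g). b h \<noteq> 0} \<subseteq> A"
  shows "conv G a b g = (\<Sum>h\<in>A. a (g \<cdot>\<^bsub>G\<^esub> ginv G h) * b h)"
  using assms unfolding conv_def by (auto intro!: sum.mono_neutral_left)

lemma conv_comb_left:
  assumes "star_finite G b"
  shows "conv G ((\<lambda>g. c * a g) + a') b = (\<lambda>g. c * conv G a b g) + conv G a' b"
proof
  fix g
  show "conv G ((\<lambda>g. c * a g) + a') b g = ((\<lambda>g. c * conv G a b g) + conv G a' b) g"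
  proof (cases "g \<in> arrows G")
    case True
    let ?A = "{h \<in> star G (orig G g). b h \<noteq> 0}"
    have "finite ?A" using assms by (simp add: star_finite_def)
    then have "conv G a'' b g = (\<Sum>h\<in>?A. a'' (g \<cdot>\<^bsub>G\<^esub> ginv G h) * b h)" for a''
      using True by (intro conv_eq_sum) auto
    then show ?thesis
      by (simp add: sum_distrib_left sum.distrib algebra_simps)
  qed (simp add: conv_def)
qed

lemma conv_comb_right:
  assumes "star_finite G b" "star_finite G b'"
  shows "conv G a ((\<lambda>g. c * b g) + b') = (\<lambda>g. c * conv G a b g) + conv G a b'"
proof
  fix g
  show "conv G a ((\<lambda>g. c * b g) + b') g = ((\<lambda>g. c * conv G a b g) + conv G a b') g"
  proof (cases "g \<in> arrows G")
    case True
    let ?A = "{h \<in> star G (orig G g). b h \<noteq> 0} \<union> {h \<in> star G (orig G g). b' h \<noteq> 0}"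
    have fin: "finite ?A" using assms by (simp add: star_finite_def)
    have eq: "conv G a b'' g = (\<Sum>h\<in>?A. a (g \<cdot>\<^bsub>G\<^esub> ginv G h) * b'' h)"
      if "\<And>h. b h = 0 \<Longrightarrow> b' h = 0 \<Longrightarrow> b'' h = 0" for b''
      using True fin that by (intro conv_eq_sum) auto
    have "conv G a b g = (\<Sum>h\<in>?A. a (g \<cdot>\<^bsub>G\<^esub> ginv G h) * b h)"
      "conv G a b' g = (\<Sum>h\<in>?A. a (g \<cdot>\<^bsub>G\<^esub> ginv G h) * b' h)"
      "conv G a ((\<lambda>g. c * b g) + b') g
        = (\<Sum>h\<in>?A. a (g \<cdot>\<^bsub>G\<^esub> ginv G h) * ((\<lambda>g. c * b g) + b') h)"
      by (intro eq; simp)+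
    then show ?thesis
      by (simp add: sum_distrib_left sum.distrib algebra_simps)
  qed (simp add: conv_def)
qed

lemma conv_zero: "conv G 0 b = 0" "conv G a 0 = 0"
  by (auto simp: conv_def)

lemma (in groupoid) star_finite_conv:
  assumes "star_finite G a" "star_finite G b"
  shows "star_finite G (conv G a b)"
  unfolding star_finite_def
proof
  fix x
  let ?P = "SIGMA h : {h \<in> star G x. b h \<noteq> 0}. {k \<in> star G (targ G h). a k \<noteq> 0}"
  have "finite ?P" using assms by (auto simp: star_finite_def)
  moreover have "{g \<in> star G x. conv G a b g \<noteq> 0} \<subseteq> (\<lambda>(h, k). k \<cdot> h) ` ?P"
  proof
    fix g assume "g \<in> {g \<in> star G x. conv G a b g \<noteq> 0}"
    then have g: "g \<in> arrows G" "orig G g = x" "conv G a b g \<noteq> 0"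
      by (auto simp: star_def)
    then obtain h where h: "h \<in> star G x" "a (g \<cdot> ginv G h) * b h \<noteq> 0"
      by (auto simp: conv_def elim!: sum.not_neutral_contains_not_neutral split: if_splits)
    have h': "h \<in> arrows G" "orig G h = x" "ginv G h \<in> arrows G" "targ G (ginv G h) = x"
      "orig G (ginv G h) = targ G h"
      using h by (auto simp: star_def inv_closed orig_inv targ_inv)
    have "g \<cdot> ginv G h \<in> star G (targ G h)"
      using g h' by (simp add: star_def comp_closed orig_comp)
    moreover have "(g \<cdot> ginv G h) \<cdot> h = g"
      using g h' comp_orig[of g] by (simp add: comp_assoc orig_def[of G h, symmetric])
    ultimately show "g \<in> (\<lambda>(h, k). k \<cdot> h) ` ?P"
      using h by (intro image_eqI[of _ _ "(h, g \<cdot> ginv G h)"]) auto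
  qed
  ultimately show "finite {g \<in> star G x. conv G a b g \<noteq> 0}"
    by (meson finite_imageI finite_subset)
qed

lemma (in groupoid) star_finite_conv_list:
  assumes "\<And>a. a \<in> set as \<Longrightarrow> star_finite G a" "as \<noteq> []"
  shows "star_finite G (conv_list G as)"
  using assms
proof (induction as rule: induct_list012)
  case (3 a b as)
  have "star_finite G (conv_list G (b # as))" by (rule 3) (use 3 in auto)
  then show ?case using 3 by (simp add: star_finite_conv)
qed auto

lemma (in groupoid) conv_list_in_span:
  assumes B: "\<And>b. b \<in> B \<Longrightarrow> star_finite G b"
    and "as \<noteq> []" "set as \<subseteq> fun_space.span B"
  shows "conv_list G as
    \<in> fun_space.span (conv_list G ` {bs. set bs \<subseteq> B \<and> length bs = length as})"
    (is "_ \<in> fun_space.span (?W (length as))")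
  using assms(2,3)
proof (induction as rule: induct_list012)
  case (2 a)
  have "b \<in> ?W (length [a])" if "b \<in> B" for b
    using that by (auto intro!: image_eqI[of _ _ "[b]"])
  then have "B \<subseteq> ?W (length [a])" by blast
  then have "fun_space.span B \<subseteq> fun_space.span (?W (length [a]))"
    by (rule fun_space.span_mono)
  then show ?case using 2 by (simp add: subset_iff)
next
  case (3 a b as)
  let ?n = "length (b # as)"
  have fin: "star_finite G w" if "w \<in> ?W ?n" for w
    using that B by (auto intro!: star_finite_conv_list)
  have conv_step: "conv G a\<^sub>0 w \<in> fun_space.span (?W (Suc ?n))"
    if "a\<^sub>0 \<in> B" "w \<in> fun_space.span (?W ?n)" for a\<^sub>0 w
  proof -
    have "star_finite G w \<and> conv G a\<^sub>0 w \<in> fun_space.span (?W (Suc ?n))"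
      using that(2)
    proof (induction rule: fun_space.span_induct_alt)
      case base
      show ?case by (simp only: conv_zero star_finite_zero fun_space.span_zero)
    next
      case (step c x y)
      then obtain d ds where ds: "x = conv_list G (d # ds)" "set (d # ds) \<subseteq> B"
        "length (d # ds) = ?n"
        by (auto simp: length_Suc_conv)
      have "conv G a\<^sub>0 x \<in> ?W (Suc ?n)"
        using ds that(1) by (intro image_eqI[of _ _ "a\<^sub>0 # d # ds"]) auto
      then have "(\<lambda>g. c * conv G a\<^sub>0 x g) + conv G a\<^sub>0 y
          \<in> fun_space.span (?W (Suc ?n))"
        using step(2) by (intro fun_space.span_add fun_space.span_scale)
          (rule fun_space.span_base, assumption, rule conjunct2)
      moreover have "star_finite G x" "star_finite G y"
        using fin[OF step(1)] step(2) by simp_all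
      ultimately show ?case
        by (simp only: conv_comb_right star_finite_comb simp_thms)
    qed
    then show ?thesis ..
  qed
  let ?c = "conv_list G (b # as)"
  have c: "?c \<in> fun_space.span (?W ?n)" using 3 by auto
  have "star_finite G ?c" using fin c by (rule star_finite_span)
  have "a \<in> fun_space.span B" using 3 by auto
  then have "conv G a ?c \<in> fun_space.span (?W (Suc ?n))"
  proof (induction rule: fun_space.span_induct_alt)
    case base
    show ?case by (simp only: conv_zero fun_space.span_zero)
  next
    case (step d x y)
    have "(\<lambda>g. d * conv G x ?c g) + conv G y ?c \<in> fun_space.span (?W (Suc ?n))"
      by (intro fun_space.span_add fun_space.span_scale conv_step c step)
    then show ?case
      using \<open>star_finite G ?c\<close> by (simp only: conv_comb_left)
  qed
  then show ?case by simp
qed simp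

lemma conv_power_finite_dimensional:
  assumes "topological_groupoid G" "finite \<S>" "\<And>F. F \<in> \<S> \<Longrightarrow> bisection G F" "n \<ge> 1"
  shows "\<exists>W. finite W \<and>
    conv_power G (fun_space.span (indicator ` \<S>)) n \<subseteq> fun_space.span W"
proof -
  interpret topological_groupoid G by fact
  let ?B = "indicator ` \<S> :: ('a \<Rightarrow> 'c) set"
  let ?W = "conv_list G ` {bs. set bs \<subseteq> ?B \<and> length bs = n}"
  have "conv_list G as \<in> fun_space.span ?W"
    if "length as = n" "set as \<subseteq> fun_space.span ?B" for as
  proof -
    have "star_finite G b" if "b \<in> ?B" for b
      using that assms by (auto intro: star_finite_bisection)
    moreover have "as \<noteq> []" using that assms by auto
    ultimately show ?thesis using conv_list_in_span[of ?B as] that by simp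
  qed
  then have "conv_power G (fun_space.span ?B) n \<subseteq> fun_space.span ?W"
    unfolding conv_power_def
    by (intro fun_space.span_minimal fun_space.subspace_span) auto
  moreover have "finite ?W"
    using assms(2) by (intro finite_imageI finite_lists_length_eq) auto
  ultimately show ?thesis by blast
qed

end

theory Submission
  imports Defs
begin

text \<open>
  The convolution product \<open>1\<^bsub>F\<^sub>1\<^esub> * \<dots> * 1\<^bsub>F\<^sub>n\<^esub>\<close> of elements \<open>F\<^sub>i\<close> of \<open>\<S>\<close> is again a function with values
  \<open>0\<close> and \<open>1\<close>.  Its value at an arrow \<open>g\<close> with origin \<open>x\<close> is the number of factorizations
  \<open>g = s\<^sub>1 \<dots> s\<^sub>n\<close> with \<open>s\<^sub>i \<in> F\<^sub>i\<close>, that is, the number of walks in the Cayley graph at \<open>x\<close> that start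
  at the root, read the labels \<open>F\<^sub>n, \<dots>, F\<^sub>1\<close> and end at \<open>g\<close>.  There is at most one, because a vertex
  has at most one incoming edge with a given label (\<open>conv_list_indicators\<close>).

  A walk of length \<open>n\<close> from the root does not leave the ball of radius \<open>n\<close>.  Hence the product
  vanishes at \<open>g\<close> when \<open>g\<close> lies outside this ball (\<open>conv_list_outside_ball\<close>), and an isomorphism of the
  balls at two units \<open>x\<close> and \<open>y\<close> carries its values on the one ball to its values on the other
  (\<open>conv_list_ball_iso\<close>).  Both properties are linear in the function, so they hold on all of \<open>V\<^sup>n\<close>.
  A function in \<open>V\<^sup>n\<close> is therefore determined by its values on the balls at one representative of
  each class of units, and these balls have together at most
  \<open>max_growth G \<S> n * complexity G \<S> n\<close> points; \<open>dim_le_card_determining_set\<close> turns this into a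
  bound on the dimension.

  Since \<open>card\<close> is \<open>0\<close> on infinite sets and \<open>Max\<close> is meaningful on finite sets only, the argument also
  needs that the number of classes is finite and that the growth is bounded.  Both follow from the
  fact that a vertex of a Cayley graph has at most \<open>2 * card \<S>\<close> neighbours: the balls of a given
  radius have bounded size, and only finitely many graphs of bounded size with labels in \<open>\<S>\<close> exist
  up to isomorphism (\<open>finite_ball_classes\<close>).

  Bisections enter through injectivity: that of \<open>targ G\<close> makes the walk with given labels and given end
  unique, that of \<open>orig G\<close> makes the convolution sums finite, and both together bound the degree.
\<close>

section \<open>Spaces of functions determined by finitely many values\<close>

lemma sum_fun_apply: "(\<Sum>i\<in>I. F i) x = (\<Sum>i\<in>I. F i x)"
  for F :: "'i \<Rightarrow> 'a \<Rightarrow> 'b::comm_monoid_add"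
  by (induction I rule: infinite_finite_induct) auto

text \<open>
  Truncating functions to \<open>P\<close> is a linear map into the span of the point masses at the elements of \<open>P\<close>.
  The hypothesis says that it is injective on the span of \<open>W\<close>.
\<close>

lemma dim_le_card_determining_set:
  fixes W :: "('a \<Rightarrow> 'k::field) set"
  assumes "finite P"
    and det: "\<And>f. f \<in> fun_space.span W \<Longrightarrow> (\<And>p. p \<in> P \<Longrightarrow> f p = 0) \<Longrightarrow> f = 0"
  shows "fun_space.dim W \<le> card P"
proof -
  interpret pair: vector_space_pair
    "\<lambda>(c :: 'k) (f :: 'a \<Rightarrow> 'k) x. c * f x" "\<lambda>(c :: 'k) (f :: 'a \<Rightarrow> 'k) x. c * f x"
    by unfold_locales
  define T where "T = (\<lambda>(f :: 'a \<Rightarrow> 'k) x. if x \<in> P then f x else 0)"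
  define D where "D = (\<lambda>p. indicator {p} :: 'a \<Rightarrow> 'k) ` P"
  have lin: "Vector_Spaces.linear (\<lambda>(c :: 'k) (f :: 'a \<Rightarrow> 'k) x. c * f x) (\<lambda>c f x. c * f x) T"
    by unfold_locales (auto simp: T_def fun_eq_iff)
  obtain B where B: "B \<subseteq> W" "fun_space.independent B" "card B = fun_space.dim W"
    using fun_space.basis_exists[of W] by metis
  have "f = 0" if "f \<in> fun_space.span B" "T f = 0" for f
  proof (rule det)
    show "f \<in> fun_space.span W" using that(1) fun_space.span_mono[OF B(1)] by blast
    show "f p = 0" if "p \<in> P" for p
      using fun_cong[OF \<open>T f = 0\<close>, of p] that by (simp add: T_def)
  qed
  then have inj: "inj_on T (fun_space.span B)"
    using pair.linear_inj_on_iff_eq_0[OF lin fun_space.subspace_span] by blast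
  have "fun_space.independent (T ` B)"
    using pair.linear_independent_injective_image[OF lin B(2) inj] .
  moreover have "T f \<in> fun_space.span D" for f
  proof -
    have "T f = (\<Sum>p\<in>P. (\<lambda>x. f p * indicator {p} x))"
    proof
      fix x
      show "T f x = (\<Sum>p\<in>P. (\<lambda>x. f p * indicator {p} x)) x"
        using assms(1) by (simp add: T_def indicator_def sum_fun_apply if_distrib[of "(*) _"] cong: if_cong)
    qed
    also have "\<dots> \<in> fun_space.span D"
      by (intro fun_space.span_sum fun_space.span_scale fun_space.span_base) (simp add: D_def)
    finally show ?thesis .
  qed
  ultimately have "card (T ` B) \<le> card D"
    using fun_space.independent_span_bound[of D "T ` B"] assms(1) by (auto simp: D_def)
  also have "card D \<le> card P" unfolding D_def using assms(1) by (rule card_image_le)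
  also have "card (T ` B) = card B"
    using inj_on_subset[OF inj fun_space.span_superset] by (rule card_image)
  finally show ?thesis using B(3) by simp
qed

section \<open>Labelled walks and isomorphisms of rooted graphs\<close>

text \<open>
  The list gives the labels in the order in which the factors of a product are written: the walk
  reads it from right to left, so that its head is the label of the last edge.
\<close>

primrec walk :: "('v, 'l) rooted_graph \<Rightarrow> 'l list \<Rightarrow> 'v \<Rightarrow> 'v \<Rightarrow> bool"
  where
    "walk \<Gamma> [] u v \<longleftrightarrow> v = u"
  | "walk \<Gamma> (A # As) u v \<longleftrightarrow> (\<exists>w. walk \<Gamma> As u w \<and> (w, A, v) \<in> edges \<Gamma>)"

definition wf_graph :: "'l set \<Rightarrow> ('v, 'l) rooted_graph \<Rightarrow> bool"
  where "wf_graph L \<Gamma> \<longleftrightarrow>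
    root \<Gamma> \<in> verts \<Gamma> \<and> edges \<Gamma> \<subseteq> verts \<Gamma> \<times> L \<times> verts \<Gamma>"

lemma walk_adjacent_pow: "walk \<Gamma> As u v \<Longrightarrow> (u, v) \<in> adjacent \<Gamma> ^^ length As"
proof (induction As arbitrary: v)
  case (Cons A As)
  then obtain w where "(u, w) \<in> adjacent \<Gamma> ^^ length As" "(w, A, v) \<in> edges \<Gamma>"
    by auto
  then show ?case by (auto simp: adjacent_def intro!: relcompI)
qed simp

lemma graph_dist_le_iff:
  "graph_dist \<Gamma> u v \<le> enat n \<longleftrightarrow> (\<exists>k\<le>n. (u, v) \<in> adjacent \<Gamma> ^^ k)"
proof -
  let ?K = "{k. (u, v) \<in> adjacent \<Gamma> ^^ k}"
  have "graph_dist \<Gamma> u v < enat (Suc n) \<longleftrightarrow> (\<exists>k\<in>?K. enat k < enat (Suc n))"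
    unfolding graph_dist_def by (rule INF_less_iff)
  moreover have "d < enat (Suc n) \<longleftrightarrow> d \<le> enat n" for d
    by (cases d) auto
  ultimately show ?thesis by (auto simp: less_Suc_eq_le)
qed

lemma verts_graph_ball:
  "verts (graph_ball \<Gamma> n) = {v \<in> verts \<Gamma>. \<exists>k\<le>n. (root \<Gamma>, v) \<in> adjacent \<Gamma> ^^ k}"
  by (simp add: graph_ball_def induced_subgraph_def graph_dist_le_iff)

lemma edges_graph_ball:
  "edges (graph_ball \<Gamma> n) = {(u, a, v) \<in> edges \<Gamma>.
    u \<in> verts (graph_ball \<Gamma> n) \<and> v \<in> verts (graph_ball \<Gamma> n)}"
  by (auto simp: graph_ball_def induced_subgraph_def)

lemma root_graph_ball: "root (graph_ball \<Gamma> n) = root \<Gamma>"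
  by (simp add: graph_ball_def induced_subgraph_def)

lemma wf_graph_ball:
  assumes "wf_graph L \<Gamma>"
  shows "wf_graph L (graph_ball \<Gamma> n)"
proof -
  have "(root \<Gamma>, root \<Gamma>) \<in> adjacent \<Gamma> ^^ 0" by simp
  then have "\<exists>k\<le>n. (root \<Gamma>, root \<Gamma>) \<in> adjacent \<Gamma> ^^ k" by (intro exI[of _ 0]) simp
  then have "root \<Gamma> \<in> verts (graph_ball \<Gamma> n)"
    using assms by (simp add: verts_graph_ball wf_graph_def)
  then show ?thesis
    using assms by (auto simp: wf_graph_def root_graph_ball edges_graph_ball)
qed

lemma walk_in_verts:
  assumes "wf_graph L \<Gamma>" "walk \<Gamma> As (root \<Gamma>) v"
  shows "v \<in> verts \<Gamma>"
  using assms by (cases As) (auto simp: wf_graph_def)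

lemma walk_in_graph_ball:
  assumes "wf_graph L \<Gamma>" "length As \<le> n" "walk \<Gamma> As (root \<Gamma>) v"
  shows "v \<in> verts (graph_ball \<Gamma> n)"
  unfolding verts_graph_ball
  using walk_in_verts[OF assms(1,3)] walk_adjacent_pow[OF assms(3)] assms(2) by auto

text \<open>
  Every vertex that a walk from the root meets is the end of an initial part of it, and so belongs
  to the ball.
\<close>

lemma walk_graph_ball:
  assumes "wf_graph L \<Gamma>" "length As \<le> n"
  shows "walk (graph_ball \<Gamma> n) As (root \<Gamma>) v \<longleftrightarrow> walk \<Gamma> As (root \<Gamma>) v"
  using assms(2)
proof (induction As arbitrary: v)
  case (Cons A As)
  have "w \<in> verts (graph_ball \<Gamma> n)" "v \<in> verts (graph_ball \<Gamma> n)"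
    if "walk \<Gamma> As (root \<Gamma>) w" "(w, A, v) \<in> edges \<Gamma>" for w
    using walk_in_graph_ball[OF assms(1), of As n w] Cons.prems that
      walk_in_graph_ball[OF assms(1), of "A # As" n v] by auto
  then show ?case using Cons by (auto simp: edges_graph_ball)
qed simp

lemma walk_iso:
  assumes "wf_graph L \<Gamma>" "wf_graph L \<Delta>"
    and bij: "bij_betw \<phi> (verts \<Gamma>) (verts \<Delta>)" and root: "\<phi> (root \<Gamma>) = root \<Delta>"
    and edges: "\<And>u v a. u \<in> verts \<Gamma> \<Longrightarrow> v \<in> verts \<Gamma> \<Longrightarrow>
      (u, a, v) \<in> edges \<Gamma> \<longleftrightarrow> (\<phi> u, a, \<phi> v) \<in> edges \<Delta>"
    and "v \<in> verts \<Gamma>"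
  shows "walk \<Delta> As (root \<Delta>) (\<phi> v) \<longleftrightarrow> walk \<Gamma> As (root \<Gamma>) v"
  using assms(6)
proof (induction As arbitrary: v)
  case Nil
  then show ?case
    using assms(1) bij root by (auto simp: wf_graph_def bij_betw_def inj_on_def)
next
  case (Cons A As)
  have "walk \<Delta> (A # As) (root \<Delta>) (\<phi> v)
      \<longleftrightarrow> (\<exists>w'\<in>verts \<Delta>. walk \<Delta> As (root \<Delta>) w' \<and> (w', A, \<phi> v) \<in> edges \<Delta>)"
    using walk_in_verts[OF assms(2)] by auto
  also have "verts \<Delta> = \<phi> ` verts \<Gamma>" using bij by (simp add: bij_betw_def)
  also have "(\<exists>w'\<in>\<phi> ` verts \<Gamma>. walk \<Delta> As (root \<Delta>) w' \<and> (w', A, \<phi> v) \<in> edges \<Delta>)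
      \<longleftrightarrow> (\<exists>w\<in>verts \<Gamma>. walk \<Gamma> As (root \<Gamma>) w \<and> (w, A, v) \<in> edges \<Gamma>)"
    using Cons edges by auto
  also have "\<dots> \<longleftrightarrow> walk \<Gamma> (A # As) (root \<Gamma>) v"
    using walk_in_verts[OF assms(1)] by auto
  finally show ?case .
qed

lemma rooted_graph_iso_refl: "rooted_graph_iso \<Gamma> \<Gamma>"
  unfolding rooted_graph_iso_def by (rule exI[of _ id]) auto

lemma rooted_graph_iso_sym:
  assumes "rooted_graph_iso \<Gamma> \<Delta>" "root \<Gamma> \<in> verts \<Gamma>"
  shows "rooted_graph_iso \<Delta> \<Gamma>"
proof -
  obtain \<phi> where \<phi>: "bij_betw \<phi> (verts \<Gamma>) (verts \<Delta>)" "\<phi> (root \<Gamma>) = root \<Delta>"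
    "\<And>u v a. u \<in> verts \<Gamma> \<Longrightarrow> v \<in> verts \<Gamma> \<Longrightarrow>
      (u, a, v) \<in> edges \<Gamma> \<longleftrightarrow> (\<phi> u, a, \<phi> v) \<in> edges \<Delta>"
    using assms(1) unfolding rooted_graph_iso_def by blast
  let ?\<psi> = "inv_into (verts \<Gamma>) \<phi>"
  have bij: "bij_betw ?\<psi> (verts \<Delta>) (verts \<Gamma>)" using \<phi>(1) by (rule bij_betw_inv_into)
  have "?\<psi> (root \<Delta>) = root \<Gamma>"
    using \<phi>(1,2) assms(2) bij_betw_inv_into_left by metis
  moreover have "(u, a, v) \<in> edges \<Delta> \<longleftrightarrow> (?\<psi> u, a, ?\<psi> v) \<in> edges \<Gamma>"
    if "u \<in> verts \<Delta>" "v \<in> verts \<Delta>" for u v a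
    using \<phi>(3)[of "?\<psi> u" "?\<psi> v" a] bij that bij_betw_inv_into_right[OF \<phi>(1)]
    by (auto simp: bij_betw_apply)
  ultimately show ?thesis unfolding rooted_graph_iso_def using bij by blast
qed

lemma rooted_graph_iso_trans:
  assumes "rooted_graph_iso \<Gamma> \<Delta>" "rooted_graph_iso \<Delta> \<Theta>"
  shows "rooted_graph_iso \<Gamma> \<Theta>"
proof -
  obtain \<phi> where \<phi>: "bij_betw \<phi> (verts \<Gamma>) (verts \<Delta>)" "\<phi> (root \<Gamma>) = root \<Delta>"
    "\<And>u v a. u \<in> verts \<Gamma> \<Longrightarrow> v \<in> verts \<Gamma> \<Longrightarrow>
      (u, a, v) \<in> edges \<Gamma> \<longleftrightarrow> (\<phi> u, a, \<phi> v) \<in> edges \<Delta>"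
    using assms(1) unfolding rooted_graph_iso_def by blast
  obtain \<psi> where \<psi>: "bij_betw \<psi> (verts \<Delta>) (verts \<Theta>)" "\<psi> (root \<Delta>) = root \<Theta>"
    "\<And>u v a. u \<in> verts \<Delta> \<Longrightarrow> v \<in> verts \<Delta> \<Longrightarrow>
      (u, a, v) \<in> edges \<Delta> \<longleftrightarrow> (\<psi> u, a, \<psi> v) \<in> edges \<Theta>"
    using assms(2) unfolding rooted_graph_iso_def by blast
  show ?thesis
    unfolding rooted_graph_iso_def
    by (rule exI[of _ "\<psi> \<circ> \<phi>"])
      (use \<phi> \<psi> bij_betw_apply[OF \<phi>(1)] in \<open>auto intro: bij_betw_trans\<close>)
qed

text \<open>
  These graphs represent all isomorphism types of graphs with at most \<open>N\<close> vertices and labels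
  in \<open>L\<close>.  A numbering of the vertices of such a graph gives an isomorphic graph on numbers below \<open>N\<close>.
\<close>

definition nat_graphs :: "'l set \<Rightarrow> nat \<Rightarrow> (nat, 'l) rooted_graph set"
  where "nat_graphs L N = (\<lambda>(W, E, r). \<lparr>verts = W, edges = E, root = r\<rparr>) `
    (Pow {..<N} \<times> Pow ({..<N} \<times> L \<times> {..<N}) \<times> {..<N})"

lemma finite_nat_graphs: "finite L \<Longrightarrow> finite (nat_graphs L N)"
  by (simp add: nat_graphs_def)

lemma iso_nat_graph:
  assumes wf: "wf_graph L \<Gamma>" and fin: "finite (verts \<Gamma>)" and card: "card (verts \<Gamma>) \<le> N"
  shows "\<exists>\<Delta>\<in>nat_graphs L N. rooted_graph_iso \<Gamma> \<Delta>"
proof -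
  obtain h where h: "bij_betw h (verts \<Gamma>) {0..<card (verts \<Gamma>)}"
    using ex_bij_betw_finite_nat[OF fin] by blast
  define E where "E = (\<lambda>(u, a, v). (h u, a, h v)) ` edges \<Gamma>"
  define \<Delta> where "\<Delta> = \<lparr>verts = h ` verts \<Gamma>, edges = E, root = h (root \<Gamma>)\<rparr>"
  have inj: "inj_on h (verts \<Gamma>)" using h by (simp add: bij_betw_def)
  have lt: "h u < N" if "u \<in> verts \<Gamma>" for u
    using bij_betw_apply[OF h that] card by auto
  have "\<Delta> \<in> nat_graphs L N"
    unfolding nat_graphs_def \<Delta>_def
    by (rule image_eqI[of _ _ "(h ` verts \<Gamma>, E, h (root \<Gamma>))"])
      (use wf lt in \<open>auto simp: E_def wf_graph_def\<close>)
  moreover have "(u, a, v) \<in> edges \<Gamma> \<longleftrightarrow> (h u, a, h v) \<in> E"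
    if "u \<in> verts \<Gamma>" "v \<in> verts \<Gamma>" for u v a
  proof
    assume "(h u, a, h v) \<in> E"
    then obtain u' v' where "(u', a, v') \<in> edges \<Gamma>" "h u = h u'" "h v = h v'"
      by (auto simp: E_def)
    moreover from this have "u' \<in> verts \<Gamma>" "v' \<in> verts \<Gamma>" using wf by (auto simp: wf_graph_def)
    ultimately show "(u, a, v) \<in> edges \<Gamma>" using inj that by (metis inj_on_eq_iff)
  qed (force simp: E_def)
  then have "rooted_graph_iso \<Gamma> \<Delta>"
    unfolding rooted_graph_iso_def \<Delta>_def using inj by (auto intro!: exI[of _ h] simp: bij_betw_def)
  ultimately show ?thesis by blast
qed

lemma card_relpow_Image:
  fixes R :: "'a rel"
  assumes "\<And>u. finite (R `` {u}) \<and> card (R `` {u}) \<le> d"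
  shows "finite ((R ^^ k) `` {u}) \<and> card ((R ^^ k) `` {u}) \<le> d ^ k"
proof (induction k)
  case (Suc k)
  let ?A = "(R ^^ k) `` {u}"
  have eq: "(R ^^ Suc k) `` {u} = (\<Union>w\<in>?A. R `` {w})" by auto
  have "card (\<Union>w\<in>?A. R `` {w}) \<le> (\<Sum>w\<in>?A. card (R `` {w}))"
    using Suc by (intro card_UN_le) simp
  also have "\<dots> \<le> card ?A * d" using sum_bounded_above[of ?A "\<lambda>w. card (R `` {w})" d] assms by simp
  also have "\<dots> \<le> d ^ Suc k" using Suc by simp
  finally show ?case unfolding eq using Suc assms by auto
qed simp

lemma card_graph_ball:
  assumes "\<And>u. finite (adjacent \<Gamma> `` {u}) \<and> card (adjacent \<Gamma> `` {u}) \<le> d"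
  shows "finite (verts (graph_ball \<Gamma> n)) \<and> card (verts (graph_ball \<Gamma> n)) \<le> (\<Sum>k\<le>n. d ^ k)"
proof -
  let ?U = "\<Union>k\<le>n. (adjacent \<Gamma> ^^ k) `` {root \<Gamma>}"
  note bound = card_relpow_Image[OF assms]
  have sub: "verts (graph_ball \<Gamma> n) \<subseteq> ?U" by (auto simp: verts_graph_ball)
  have fin: "finite ?U" using bound by blast
  have "card (verts (graph_ball \<Gamma> n)) \<le> card ?U" using fin sub by (rule card_mono)
  also have "\<dots> \<le> (\<Sum>k\<le>n. card ((adjacent \<Gamma> ^^ k) `` {root \<Gamma>}))" by (rule card_UN_le) simp
  also have "\<dots> \<le> (\<Sum>k\<le>n. d ^ k)" using bound by (intro sum_mono) blast
  finally show ?thesis using finite_subset[OF sub fin] by blast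
qed

section \<open>Cayley graphs of groupoids\<close>

context groupoid
begin

lemma orig_orig: "g \<in> arrows G \<Longrightarrow> orig G (orig G g) = orig G g"
  using orig_comp[of "ginv G g" g] by (simp add: orig_def[of G g] inv_closed orig_inv)

lemma targ_orig: "g \<in> arrows G \<Longrightarrow> targ G (orig G g) = orig G g"
  using targ_comp[of "ginv G g" g]
  by (simp add: orig_def[of G g, symmetric] inv_closed orig_inv targ_inv)

lemma orig_closed: "g \<in> arrows G \<Longrightarrow> orig G g \<in> arrows G"
  using comp_closed[of "ginv G g" g] by (simp add: orig_def[of G g] inv_closed orig_inv)

lemma unitD:
  assumes "x \<in> units G"
  shows "x \<in> arrows G" "orig G x = x" "targ G x = x"
  using assms by (auto simp: units_def orig_closed orig_orig targ_orig)

lemma comp_inv_cancel: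
  assumes "s \<in> arrows G" "h \<in> arrows G" "targ G h = orig G s"
  shows "(s \<cdot> h) \<cdot> ginv G h = s"
  using assms comp_assoc[of s h "ginv G h"] comp_orig[of s]
  by (simp add: inv_closed targ_inv targ_def[of G h, symmetric])

lemma inv_comp_cancel:
  assumes "s \<in> arrows G" "h \<in> arrows G" "targ G h = orig G s"
  shows "ginv G s \<cdot> (s \<cdot> h) = h"
  using assms comp_assoc[of "ginv G s" s h] targ_comp_id[of h]
  by (simp add: inv_closed orig_inv orig_def[of G s, symmetric])

lemma comp_inv_comp:
  assumes "g \<in> arrows G" "h \<in> arrows G" "orig G g = orig G h"
  shows "(g \<cdot> ginv G h) \<cdot> h = g"
  using assms comp_assoc[of g "ginv G h" h] comp_orig[of g]
  by (simp add: inv_closed targ_inv orig_inv orig_def[of G h, symmetric])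

end

text \<open>
  The algebraic data that a finite set of bisections provides; walks are traced and balls are
  counted on this level.
\<close>

locale finite_bisection_family = groupoid G
  for G :: "('g, 'm) groupoid_scheme" (structure) +
  fixes \<S> :: "'g set set"
  assumes finite_labels: "finite \<S>"
    and label_subset: "F \<in> \<S> \<Longrightarrow> F \<subseteq> arrows G"
    and inj_orig: "F \<in> \<S> \<Longrightarrow> inj_on (orig G) F"
    and inj_targ: "F \<in> \<S> \<Longrightarrow> inj_on (targ G) F"
begin

lemma cayley_edge_iff:
  assumes "F \<in> \<S>" "h \<in> star G x" "g \<in> star G x"
  shows "(h, F, g) \<in> edges (cayley_graph G \<S> x) \<longleftrightarrow> g \<cdot> ginv G h \<in> F"
proof -
  have "(\<exists>s\<in>F. targ G h = orig G s \<and> g = s \<cdot> h) \<longleftrightarrow> g \<cdot> ginv G h \<in> F"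
  proof
    assume "\<exists>s\<in>F. targ G h = orig G s \<and> g = s \<cdot> h"
    then show "g \<cdot> ginv G h \<in> F"
      using assms label_subset[OF assms(1)]
      by (auto simp: star_def comp_inv_cancel subset_iff)
  next
    assume "g \<cdot> ginv G h \<in> F"
    moreover have "targ G h = orig G (g \<cdot> ginv G h)" "g = (g \<cdot> ginv G h) \<cdot> h"
      using assms by (auto simp: star_def comp_inv_comp orig_comp inv_closed targ_inv orig_inv)
    ultimately show "\<exists>s\<in>F. targ G h = orig G s \<and> g = s \<cdot> h" by blast
  qed
  then show ?thesis using assms by (simp add: cayley_graph_def)
qed

lemma cayley_edge_in_star:
  "(h, F, g) \<in> edges (cayley_graph G \<S> x) \<Longrightarrow> h \<in> star G x \<and> F \<in> \<S> \<and> g \<in> star G x"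
  by (auto simp: cayley_graph_def)

lemma wf_cayley_graph: "x \<in> units G \<Longrightarrow> wf_graph \<S> (cayley_graph G \<S> x)"
  by (auto simp: wf_graph_def cayley_graph_def star_def unitD)

text \<open>
  A label determines at most one edge out of a vertex, as \<open>orig G\<close> is injective on it, and at most one
  edge into a vertex, as \<open>targ G\<close> is: in \<open>v = s \<cdot> u\<close> the target of \<open>s\<close> is that of \<open>v\<close>, so \<open>v\<close> determines \<open>s\<close>
  and with it \<open>u\<close>.
\<close>

lemma cayley_edge_functional:
  assumes "(u, F, v) \<in> edges (cayley_graph G \<S> x)" "(u, F, v') \<in> edges (cayley_graph G \<S> x)"
  shows "v = v'"
proof -
  obtain s s' where "s \<in> F" "s' \<in> F" "orig G s = orig G s'" "v = s \<cdot> u" "v' = s' \<cdot> u"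
    and "F \<in> \<S>"
    using assms by (auto simp: cayley_graph_def)
  then show ?thesis using inj_onD[OF inj_orig] by metis
qed

lemma cayley_edge_injective:
  assumes "(u, F, v) \<in> edges (cayley_graph G \<S> x)" "(u', F, v) \<in> edges (cayley_graph G \<S> x)"
  shows "u = u'"
proof -
  obtain s s' where s: "s \<in> F" "targ G u = orig G s" "v = s \<cdot> u"
    and s': "s' \<in> F" "targ G u' = orig G s'" "v = s' \<cdot> u'"
    and F: "F \<in> \<S>" and u: "u \<in> arrows G" "u' \<in> arrows G"
    using assms by (auto simp: cayley_graph_def star_def)
  have arr: "s \<in> arrows G" "s' \<in> arrows G" using s s' F label_subset by auto
  have "targ G s = targ G s'"
    using targ_comp[of s u] targ_comp[of s' u'] s s' arr u by simp
  then have "s = s'" using inj_targ[OF F] s s' by (auto dest: inj_onD)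
  then show ?thesis
    using inv_comp_cancel[of s u] inv_comp_cancel[of s' u'] s s' arr u by simp
qed

lemma card_cayley_neighbours:
  "finite (adjacent (cayley_graph G \<S> x) `` {u}) \<and>
    card (adjacent (cayley_graph G \<S> x) `` {u}) \<le> 2 * card \<S>"
proof -
  let ?E = "edges (cayley_graph G \<S> x)"
  \<comment> \<open>Send a label to the other end of its edge out of \<open>u\<close>, respectively into \<open>u\<close>; the values of these
    maps on labels without such an edge are arbitrary and only enlarge the union below.\<close>
  let ?out = "(\<lambda>A. THE v. (u, A, v) \<in> ?E)" and ?in = "(\<lambda>A. THE v. (v, A, u) \<in> ?E)"
  have out: "?out A = v" if "(u, A, v) \<in> ?E" for A v
    using that cayley_edge_functional by (blast intro: the_equality)
  have inn: "?in A = v" if "(v, A, u) \<in> ?E" for A v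
    using that cayley_edge_injective by (blast intro: the_equality)
  have sub: "adjacent (cayley_graph G \<S> x) `` {u} \<subseteq> ?out ` \<S> \<union> ?in ` \<S>"
  proof
    fix v assume "v \<in> adjacent (cayley_graph G \<S> x) `` {u}"
    then obtain A where "(u, A, v) \<in> ?E \<or> (v, A, u) \<in> ?E" by (auto simp: adjacent_def)
    then show "v \<in> ?out ` \<S> \<union> ?in ` \<S>"
      using out[of A v] inn[of v A] cayley_edge_in_star by blast
  qed
  have "card (?out ` \<S> \<union> ?in ` \<S>) \<le> card (?out ` \<S>) + card (?in ` \<S>)" by (rule card_Un_le)
  also have "\<dots> \<le> card \<S> + card \<S>"
    using finite_labels by (intro add_mono card_image_le)
  finally have "card (?out ` \<S> \<union> ?in ` \<S>) \<le> 2 * card \<S>" by simp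
  moreover have fin: "finite (?out ` \<S> \<union> ?in ` \<S>)" using finite_labels by simp
  ultimately show ?thesis using card_mono[OF fin sub] finite_subset[OF sub fin] by simp
qed

lemma card_cayley_ball:
  "finite (verts (cayley_ball G \<S> x n)) \<and>
    card (verts (cayley_ball G \<S> x n)) \<le> (\<Sum>k\<le>n. (2 * card \<S>) ^ k)"
  unfolding cayley_ball_def by (rule card_graph_ball) (rule card_cayley_neighbours)

lemma growth_le_max_growth:
  assumes "x \<in> units G"
  shows "growth G \<S> x n \<le> max_growth G \<S> n"
proof -
  have "finite ((\<lambda>x. growth G \<S> x n) ` units G)"
    by (rule finite_subset[of _ "{..\<Sum>k\<le>n. (2 * card \<S>) ^ k}"])
      (use card_cayley_ball in \<open>auto simp: growth_def\<close>)
  then show ?thesis unfolding max_growth_def using assms by (intro Max_ge) auto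
qed

lemma wf_cayley_ball: "x \<in> units G \<Longrightarrow> wf_graph \<S> (cayley_ball G \<S> x n)"
  unfolding cayley_ball_def by (intro wf_graph_ball wf_cayley_graph)

text \<open>
  The class of \<open>x\<close> is determined by any of the graphs in \<open>nat_graphs\<close> that is isomorphic to the ball at \<open>x\<close>,
  and there are only finitely many candidates.
\<close>

lemma finite_ball_classes: "finite (units G // ball_equiv G \<S> n)"
proof -
  define N where "N = (\<Sum>k\<le>n. (2 * card \<S>) ^ k)"
  define cls where "cls = (\<lambda>\<Delta> :: (nat, 'g set) rooted_graph.
    {y \<in> units G. rooted_graph_iso \<Delta> (cayley_ball G \<S> y n)})"
  have "ball_equiv G \<S> n `` {x} \<in> cls ` nat_graphs \<S> N" if x: "x \<in> units G" for x
  proof -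
    let ?B = "cayley_ball G \<S> x n"
    obtain \<Delta> where \<Delta>: "\<Delta> \<in> nat_graphs \<S> N" "rooted_graph_iso ?B \<Delta>"
      using iso_nat_graph[OF wf_cayley_ball[OF x]] card_cayley_ball[of x n] N_def by blast
    have \<Delta>': "rooted_graph_iso \<Delta> ?B"
      using rooted_graph_iso_sym[OF \<Delta>(2)] wf_cayley_ball[OF x] by (auto simp: wf_graph_def)
    then have "rooted_graph_iso ?B (cayley_ball G \<S> y n)
        \<longleftrightarrow> rooted_graph_iso \<Delta> (cayley_ball G \<S> y n)" for y
      using rooted_graph_iso_trans[OF \<Delta>(2)] rooted_graph_iso_trans[OF \<Delta>'] by blast
    then have "ball_equiv G \<S> n `` {x} = cls \<Delta>"
      using x by (auto simp: ball_equiv_def cls_def)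
    then show ?thesis using \<Delta>(1) by blast
  qed
  then have "units G // ball_equiv G \<S> n \<subseteq> cls ` nat_graphs \<S> N"
    by (auto simp: quotient_def)
  then show ?thesis using finite_nat_graphs[OF finite_labels] finite_subset by blast
qed

section \<open>Convolution products as functions on Cayley graphs\<close>

lemma star_finite_indicator:
  assumes "F \<in> \<S>"
  shows "star_finite G (indicator F :: 'g \<Rightarrow> 'k::field)"
  unfolding star_finite_def
proof
  fix x
  have "{h \<in> star G x. indicator F h \<noteq> (0::'k)} \<subseteq> {inv_into F (orig G) x}"
    using inj_orig[OF assms] by (auto simp: star_def indicator_def)
  then show "finite {h \<in> star G x. indicator F h \<noteq> (0::'k)}"
    by (rule finite_subset) simp
qed

text \<open>
  In the convolution sum of \<open>1\<^bsub>F\<^esub>\<close> with a product that is already known, the terms \<open>h\<close> that survive are the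
  last but one vertices of walks to \<open>g\<close> whose last edge has the label \<open>F\<close>.  There is at most one such \<open>h\<close>, so
  the sum is \<open>0\<close> or \<open>1\<close> whatever the characteristic of the field.
\<close>

lemma conv_list_indicators:
  assumes "Fs \<noteq> []" "set Fs \<subseteq> \<S>"
  shows "conv_list G (map indicator Fs) g
    = (of_bool (g \<in> arrows G \<and> walk (cayley_graph G \<S> (orig G g)) Fs (orig G g) g) :: 'k::field)"
  using assms
proof (induction Fs arbitrary: g rule: induct_list012)
  case (2 F)
  have "g \<in> F \<longleftrightarrow> g \<in> arrows G \<and> (orig G g, F, g) \<in> edges (cayley_graph G \<S> (orig G g))"
  proof (cases "g \<in> arrows G")
    case True
    then have x: "orig G g \<in> units G" by (simp add: units_def)
    have "g \<cdot> ginv G (orig G g) = g"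
      using comp_inv_cancel[of g "orig G g"] True unitD[OF x] comp_orig[of g] by simp
    then show ?thesis
      using cayley_edge_iff[of F "orig G g" "orig G g" g] 2 True unitD[OF x]
      by (simp add: star_def)
  qed (use 2 label_subset in auto)
  then show ?case by (auto simp: indicator_def)
next
  case (3 F F' Fs)
  let ?b = "conv_list G (map indicator (F' # Fs)) :: 'g \<Rightarrow> 'k"
  let ?x = "orig G g" and ?\<Gamma> = "cayley_graph G \<S> (orig G g)"
  have b: "?b h = of_bool (h \<in> arrows G \<and>
      walk (cayley_graph G \<S> (orig G h)) (F' # Fs) (orig G h) h)" for h
    using 3 by (intro 3(2)) auto
  show ?case
  proof (cases "g \<in> arrows G")
    case True
    \<comment> \<open>The vertices from which an edge labelled \<open>F\<close> leads to \<open>g\<close> and at which the remaining product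
      is not zero.\<close>
    define H where "H = {h. walk ?\<Gamma> (F' # Fs) ?x h \<and> (h, F, g) \<in> edges ?\<Gamma>}"
    have nz: "indicator F (g \<cdot> ginv G h) * ?b h = of_bool (h \<in> H)" if "h \<in> star G ?x" for h
      using that cayley_edge_iff[of F h ?x g] 3(4) True b[of h]
      by (simp add: star_def H_def indicator_def)
    have "H \<subseteq> star G ?x" using cayley_edge_in_star by (auto simp: H_def)
    then have terms: "{h. h \<in> star G ?x \<and> indicator F (g \<cdot> ginv G h) * ?b h \<noteq> 0} = H"
    proof -
      have "indicator F (g \<cdot> ginv G h) * ?b h \<noteq> 0 \<longleftrightarrow> h \<in> H" if "h \<in> star G ?x" for h
        unfolding nz[OF that] by simp
      then show ?thesis using \<open>H \<subseteq> star G ?x\<close> by blast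
    qed
    have "conv G (indicator F) ?b g = (\<Sum>h\<in>H. indicator F (g \<cdot> ginv G h) * ?b h)"
      unfolding conv_def terms using True by simp
    also have "\<dots> = (\<Sum>h\<in>H. 1)"
      using nz \<open>H \<subseteq> star G ?x\<close> by (intro sum.cong) auto
    also have "\<dots> = of_bool (H \<noteq> {})"
    proof -
      have "h = h'" if "h \<in> H" "h' \<in> H" for h h'
        using that cayley_edge_injective by (auto simp: H_def)
      then have "H = {} \<or> (\<exists>h. H = {h})" by blast
      then show ?thesis by auto
    qed
    also have "H \<noteq> {} \<longleftrightarrow> walk ?\<Gamma> (F # F' # Fs) ?x g" by (auto simp: H_def)
    finally show ?thesis using True by simp
  qed (simp add: conv_def)
qed simp

lemma in_cayley_ballD:
  assumes "g \<in> verts (cayley_ball G \<S> x n)"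
  shows "g \<in> arrows G" "orig G g = x"
  using assms by (auto simp: cayley_ball_def verts_graph_ball cayley_graph_def star_def)

lemma walk_cayley_ball_iff:
  assumes "x \<in> units G" "length Fs \<le> n"
  shows "walk (cayley_ball G \<S> x n) Fs x v \<longleftrightarrow> walk (cayley_graph G \<S> x) Fs x v"
  using walk_graph_ball[OF wf_cayley_graph[OF assms(1)] assms(2), of v]
  by (simp add: cayley_ball_def cayley_graph_def)

lemma conv_list_outside_ball:
  assumes "Fs \<noteq> []" "set Fs \<subseteq> \<S>" "length Fs \<le> n"
    and "g \<notin> verts (cayley_ball G \<S> (orig G g) n)"
  shows "conv_list G (map indicator Fs) g = (0 :: 'k::field)"
proof -
  have "\<not> walk (cayley_graph G \<S> (orig G g)) Fs (orig G g) g" if "g \<in> arrows G"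
  proof
    assume "walk (cayley_graph G \<S> (orig G g)) Fs (orig G g) g"
    moreover have "orig G g \<in> units G" using that by (simp add: units_def)
    ultimately show False
      using walk_in_graph_ball[OF wf_cayley_graph assms(3)] assms(4)
      by (auto simp: cayley_ball_def cayley_graph_def)
  qed
  then show ?thesis unfolding conv_list_indicators[OF assms(1,2)] by auto
qed

lemma conv_list_ball_iso:
  assumes "Fs \<noteq> []" "set Fs \<subseteq> \<S>" "length Fs \<le> n"
    and "x \<in> units G" "y \<in> units G"
    and "bij_betw \<phi> (verts (cayley_ball G \<S> x n)) (verts (cayley_ball G \<S> y n))" "\<phi> x = y"
    and "\<And>u v a. u \<in> verts (cayley_ball G \<S> x n) \<Longrightarrow> v \<in> verts (cayley_ball G \<S> x n) \<Longrightarrow>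
      (u, a, v) \<in> edges (cayley_ball G \<S> x n) \<longleftrightarrow>
      (\<phi> u, a, \<phi> v) \<in> edges (cayley_ball G \<S> y n)"
    and g: "g \<in> verts (cayley_ball G \<S> x n)"
  shows "conv_list G (map indicator Fs) (\<phi> g)
    = (conv_list G (map indicator Fs) g :: 'k::field)"
proof -
  have root: "root (cayley_ball G \<S> z n) = z" for z
    by (simp add: cayley_ball_def root_graph_ball cayley_graph_def)
  have "walk (cayley_ball G \<S> y n) Fs y (\<phi> g) \<longleftrightarrow> walk (cayley_ball G \<S> x n) Fs x g"
    using walk_iso[OF wf_cayley_ball[OF assms(4)] wf_cayley_ball[OF assms(5)], of \<phi> n n]
      assms root by simp
  then have "walk (cayley_graph G \<S> y) Fs y (\<phi> g) \<longleftrightarrow> walk (cayley_graph G \<S> x) Fs x g"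
    using walk_cayley_ball_iff assms(3-5) by simp
  moreover have "\<phi> g \<in> verts (cayley_ball G \<S> y n)" using assms(6) g bij_betw_apply by metis
  ultimately show ?thesis
    unfolding conv_list_indicators[OF assms(1,2)]
    using in_cayley_ballD[OF g] in_cayley_ballD[of "\<phi> g" y n] by simp
qed

lemma exists_class_representatives:
  "\<exists>R\<subseteq>units G. finite R \<and> card R \<le> complexity G \<S> n \<and>
    (\<forall>x\<in>units G. \<exists>y\<in>R. (x, y) \<in> ball_equiv G \<S> n)"
proof -
  let ?Q = "units G // ball_equiv G \<S> n"
  define R where "R = (\<lambda>C. SOME x. x \<in> C) ` ?Q"
  have chosen: "(x, SOME y. y \<in> ball_equiv G \<S> n `` {x}) \<in> ball_equiv G \<S> n"
    if "x \<in> units G" for x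
  proof -
    have "x \<in> ball_equiv G \<S> n `` {x}"
      using that by (simp add: ball_equiv_def rooted_graph_iso_refl)
    then show ?thesis using someI[of "\<lambda>y. y \<in> ball_equiv G \<S> n `` {x}" x] by blast
  qed
  have "R \<subseteq> units G"
    using chosen by (auto simp: R_def quotient_def ball_equiv_def)
  moreover have "finite R" "card R \<le> complexity G \<S> n"
    unfolding R_def complexity_def using finite_ball_classes by (auto intro: card_image_le)
  moreover have "\<exists>y\<in>R. (x, y) \<in> ball_equiv G \<S> n" if "x \<in> units G" for x
    using chosen[OF that] that by (auto simp: R_def quotient_def)
  ultimately show ?thesis by blast
qed

text \<open>
  A function in the power vanishes as soon as it vanishes on the balls at one representative of each
  class: an isomorphism that preserves its values carries any other ball onto one of these.
\<close>

theorem dim_conv_power_le: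
  assumes "n \<ge> 1"
  shows "fun_space.dim (conv_power G (fun_space.span (indicator ` \<S> :: ('g \<Rightarrow> 'k::field) set)) n)
    \<le> max_growth G \<S> n * complexity G \<S> n"
proof -
  \<comment> \<open>By multilinearity of the product, products of indicators already span the power.\<close>
  let ?I = "indicator ` \<S> :: ('g \<Rightarrow> 'k) set"
  define M where "M = conv_power G (fun_space.span ?I) n"
  define W where "W = (\<lambda>Fs. conv_list G (map indicator Fs) :: 'g \<Rightarrow> 'k) `
    {Fs. set Fs \<subseteq> \<S> \<and> length Fs = n}"
  have "conv_list G as \<in> fun_space.span W"
    if "length as = n" "set as \<subseteq> fun_space.span ?I" for as
  proof -
    have "conv_list G as
        \<in> fun_space.span (conv_list G ` {bs. set bs \<subseteq> ?I \<and> length bs = length as})"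
      using that assms star_finite_indicator by (intro conv_list_in_span) auto
    also have "conv_list G ` {bs. set bs \<subseteq> ?I \<and> length bs = length as} \<subseteq> W"
    proof clarify
      fix bs :: "('g \<Rightarrow> 'k) list"
      assume bs: "set bs \<subseteq> ?I" "length bs = length as"
      then have "bs \<in> map indicator ` lists \<S>" by (simp add: lists_image[symmetric] in_lists_conv_set subset_iff)
      then show "conv_list G bs \<in> W" using bs that by (auto simp: W_def)
    qed
    then have "fun_space.span (conv_list G ` {bs. set bs \<subseteq> ?I \<and> length bs = length as})
        \<subseteq> fun_space.span W" by (rule fun_space.span_mono)
    finally show ?thesis .
  qed
  then have span: "fun_space.span M \<subseteq> fun_space.span W"
    unfolding M_def conv_power_def
    by (intro fun_space.span_minimal fun_space.subspace_span) auto
  \<comment> \<open>A linear relation between the values at two points passes from the products of indicators to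
    their span.  It is used with \<open>c = 1\<close> for points that correspond under an isomorphism of balls and
    with \<open>c = 0\<close> for points outside the balls.\<close>
  have transfer: "f g = c * f h"
    if f: "f \<in> fun_space.span M"
      and w: "\<And>Fs. Fs \<noteq> [] \<Longrightarrow> set Fs \<subseteq> \<S> \<Longrightarrow> length Fs \<le> n \<Longrightarrow>
        conv_list G (map indicator Fs) g = (c * conv_list G (map indicator Fs) h :: 'k)"
    for f :: "'g \<Rightarrow> 'k" and g h c
  proof -
    have "f \<in> fun_space.span W" using f span by blast
    then show ?thesis
    proof (induction rule: fun_space.span_induct_alt)
      case (step d w f')
      obtain Fs where Fs: "set Fs \<subseteq> \<S>" "length Fs = n"
        and "w = conv_list G (map indicator Fs)"
        using step(1) by (auto simp: W_def)
      moreover have "Fs \<noteq> []" using Fs assms by auto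
      ultimately have "w g = c * w h" using w[of Fs] by simp
      then show ?case by (simp add: step(2) distrib_left mult.left_commute)
    qed simp
  qed
  obtain R where R: "R \<subseteq> units G" "finite R" "card R \<le> complexity G \<S> n"
    "\<forall>x\<in>units G. \<exists>y\<in>R. (x, y) \<in> ball_equiv G \<S> n"
    using exists_class_representatives[of n] by (elim exE conjE)
  define P where "P = (\<Union>y\<in>R. verts (cayley_ball G \<S> y n))"
  have "f = 0" if f: "f \<in> fun_space.span M" and zero: "\<And>p. p \<in> P \<Longrightarrow> f p = 0" for f
  proof
    fix g
    let ?x = "orig G g"
    show "f g = 0 g"
    proof (cases "g \<in> verts (cayley_ball G \<S> ?x n)")
      case True
      then have "g \<in> arrows G" by (rule in_cayley_ballD)
      then have x: "?x \<in> units G" by (simp add: units_def)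
      then obtain y where y: "y \<in> R" "(?x, y) \<in> ball_equiv G \<S> n" using R(4) by blast
      then obtain \<phi> where \<phi>:
        "bij_betw \<phi> (verts (cayley_ball G \<S> ?x n)) (verts (cayley_ball G \<S> y n))"
        "\<phi> ?x = y"
        "\<And>u v a. u \<in> verts (cayley_ball G \<S> ?x n) \<Longrightarrow> v \<in> verts (cayley_ball G \<S> ?x n) \<Longrightarrow>
          (u, a, v) \<in> edges (cayley_ball G \<S> ?x n) \<longleftrightarrow>
          (\<phi> u, a, \<phi> v) \<in> edges (cayley_ball G \<S> y n)"
        by (auto simp: ball_equiv_def rooted_graph_iso_def cayley_ball_def root_graph_ball
            cayley_graph_def)
      have "y \<in> units G" using y R(1) by blast
      then have "f g = 1 * f (\<phi> g)"
        by (intro transfer[OF f]) (simp add: conv_list_ball_iso[OF _ _ _ x _ \<phi> True])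
      moreover have "\<phi> g \<in> P" using bij_betw_apply[OF \<phi>(1) True] y(1) by (auto simp: P_def)
      ultimately show ?thesis using zero by simp
    next
      case False
      have "f g = 0 * f g"
        by (intro transfer[OF f]) (simp add: conv_list_outside_ball[OF _ _ _ False])
      then show ?thesis by simp
    qed
  qed
  then have "fun_space.dim M \<le> card P"
    using card_cayley_ball R(2) by (intro dim_le_card_determining_set) (auto simp: P_def)
  also have "\<dots> \<le> (\<Sum>y\<in>R. growth G \<S> y n)"
    unfolding P_def growth_def using R(2) by (rule card_UN_le)
  also have "\<dots> \<le> (\<Sum>y\<in>R. max_growth G \<S> n)"
    using R(1) growth_le_max_growth by (intro sum_mono) blast
  also have "\<dots> = card R * max_growth G \<S> n" by simp
  also have "\<dots> \<le> max_growth G \<S> n * complexity G \<S> n"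
    using R(3) by simp
  finally show ?thesis unfolding M_def .
qed

end

lemma bisection_inj:
  assumes "topological_groupoid G" "bisection G F"
  shows "inj_on (orig G) F" "inj_on (targ G) F"
proof -
  have "topspace (topo G) \<inter> F = F"
    using assms by (auto simp: bisection_def topological_groupoid.topspace_topo)
  then show "inj_on (orig G) F" "inj_on (targ G) F"
    using assms(2) by (auto simp: bisection_def homeomorphic_map_def)
qed

theorem theorem1p1:
  fixes G :: "'g top_groupoid"
    and \<S> :: "'g set set"
    and V :: "('g \<Rightarrow> 'k::field) set"
    and n :: nat
  assumes "etale_groupoid G"
    and "compact_space (unit_space G)"
    and "totally_disconnected_space (unit_space G)"
    and "metrizable_space (unit_space G)"
    and "finite \<S>"
    and "\<And>F. F \<in> \<S> \<Longrightarrow> open_compact_bisection G F"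
    and "generating_set G (\<Union>\<S>)"
    and "V = fun_space.span (indicator ` \<S>)"
    and "n \<ge> 1"
  shows "fun_space.dim (conv_power G V n) \<le> max_growth G \<S> n * complexity G \<S> n"
proof -
  have top: "topological_groupoid G"
    using assms(1) by (rule etale_groupoid.axioms)
  have bis: "bisection G F" if "F \<in> \<S>" for F
    using assms(6)[OF that] by (simp add: open_compact_bisection_def)
  interpret finite_bisection_family G \<S>
  proof (intro finite_bisection_family.intro finite_bisection_family_axioms.intro)
    show "groupoid G" using top by (rule topological_groupoid.axioms)
    show "F \<subseteq> arrows G" if "F \<in> \<S>" for F
      using bis[OF that] by (simp add: bisection_def)
  qed (use assms(5) bisection_inj[OF top bis] in auto)
  show ?thesis using dim_conv_power_le[OF assms(9)] assms(8) by simp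
qed

end
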